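(* Let $(M^{2n+1},\varphi,Q,\xi,\eta,g)$ be a weak almost contact B-metric manifold with contact distribution $\mathcal{D}=\operatorname{Ker}\eta$, and let $\nabla$ be the Levi-Civita connection of $g$. Then the following are equivalent: (i) $\mathcal{D}$ is parallel, i.e. $\nabla_XY\in\Gamma(\mathcal{D})$ for all $X\in\chi(M)$ and $Y\in\Gamma(\mathcal{D})$; (ii) $\eta$ is parallel, i.e. $\nabla\eta=0$; (iii) $\xi$ is parallel, i.e. $\nabla\xi=0$.
   Context: $\chi(M)$ denotes the smooth vector fields on $M$ and $\Gamma(\mathcal{D})$ the smooth sections of a distribution $\mathcal{D}$. A smooth manifold $M^{2n+1}$ ($n\ge 1$) carries a weak almost contact structure $(\varphi,Q,\xi,\eta)$ if it admits a $(1,1)$-tensor field $\varphi$, a nonsingular $(1,1)$-tensor field $Q$, a vector field $\xi$ and a 1-form $\eta$ such that $\varphi^2=-Q+\eta\otimes\xi$, $\eta(\xi)=1$, $Q\xi=\xi$, and $\mathcal{D}:=\operatorname{Ker}\eta$ (the contact distribution) is $\varphi$-invariant, i.e. $\varphi(\mathcal{D})\subset\mathcal{D}$. Here $(\eta\otimes\xi)(X)=\eta(X)\xi$. If moreover $g$ is a (semi-)Riemannian metric on $M$ (Riemannian or indefinite) with $g(\varphi X,\varphi Y)=-g(X,QY)+\eta(X)\eta(Y)$ for all $X,Y\in\chi(M)$, then $(M^{2n+1},\varphi,Q,\xi,\eta,g)$ is called a weak almost contact B-metric manifold. *)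

theory Defs
  imports "HOL-Analysis.Analysis" "HOL-Library.Function_Algebras"
begin

subsection \<open>Smooth maps between Euclidean spaces\<close>

text \<open>To be used on open sets \<open>S\<close> only.\<close>

primrec differentiable_up_to ::
    "nat \<Rightarrow> 'e::real_normed_vector set \<Rightarrow> ('e \<Rightarrow> 'f::real_normed_vector) \<Rightarrow> bool" where
  "differentiable_up_to 0 S f \<longleftrightarrow> continuous_on S f"
| "differentiable_up_to (Suc k) S f \<longleftrightarrow>
     (\<forall>x\<in>S. f differentiable (at x)) \<and>
     (\<forall>v. differentiable_up_to k S (\<lambda>x. frechet_derivative f (at x) v))"

definition smooth_on :: "'e::real_normed_vector set \<Rightarrow> ('e \<Rightarrow> 'f::real_normed_vector) \<Rightarrow> bool" where
  "smooth_on S f \<longleftrightarrow> (\<forall>k. differentiable_up_to k S f)"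


subsection \<open>Smooth manifolds\<close>

text \<open>A chart \<open>(U, x)\<close> consists of its domain and its coordinate map; the values of \<open>x\<close>
  outside \<open>U\<close> are irrelevant. A manifold is a topology together with a smooth atlas, which need
  not be maximal: its smooth functions are those of the maximal atlas it generates.\<close>

type_synonym ('a, 'e) chart = "'a set \<times> ('a \<Rightarrow> 'e)"

definition is_chart :: "'a topology \<Rightarrow> ('a, 'e::euclidean_space) chart \<Rightarrow> bool" where
  "is_chart T = (\<lambda>(U, x). openin T U \<and> open (x ` U) \<and>
     homeomorphic_map (subtopology T U) (top_of_set (x ` U)) x)"

definition smooth_transition ::
    "('a, 'e::euclidean_space) chart \<Rightarrow> ('a, 'e) chart \<Rightarrow> bool" where
  "smooth_transition = (\<lambda>(U, x) (V, y). smooth_on (x ` (U \<inter> V)) (y \<circ> inv_into U x))"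

definition smooth_manifold ::
    "'a topology \<Rightarrow> ('a, 'e::euclidean_space) chart set \<Rightarrow> bool" where
  "smooth_manifold T A \<longleftrightarrow>
     Hausdorff_space T \<and> second_countable T \<and>
     (\<forall>c\<in>A. is_chart T c) \<and>
     (\<Union>c\<in>A. fst c) = topspace T \<and>
     (\<forall>c\<in>A. \<forall>d\<in>A. smooth_transition c d)"

definition points :: "('a, 'e::euclidean_space) chart set \<Rightarrow> 'a set" where
  "points A = (\<Union>c\<in>A. fst c)"

text \<open>The values of \<open>f\<close> outside the manifold are unconstrained. This is harmless: a derivation in
  the sense of \<open>tangent_space\<close> takes the same value on functions that agree on the manifold, by the
  Leibniz rule applied to the product of their difference with the indicator of the complement.\<close>

definition smooth_functions :: "('a, 'e::euclidean_space) chart set \<Rightarrow> ('a \<Rightarrow> real) set" where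
  "smooth_functions A = {f. \<forall>(U, x)\<in>A. smooth_on (x ` U) (f \<circ> inv_into U x)}"


subsection \<open>Tangent vectors and vector fields\<close>

type_synonym 'a tangent = "('a \<Rightarrow> real) \<Rightarrow> real"
type_synonym 'a field = "'a \<Rightarrow> 'a tangent"

text \<open>Sums and zeros of tangent vectors and of vector fields are the pointwise ones.\<close>

definition scale_tangent :: "real \<Rightarrow> 'a tangent \<Rightarrow> 'a tangent" (infixr "*\<^sub>t" 75) where
  "c *\<^sub>t v = (\<lambda>f. c * v f)"

definition scale_field :: "('a \<Rightarrow> real) \<Rightarrow> 'a field \<Rightarrow> 'a field" (infixr "*\<^sub>f" 75) where
  "h *\<^sub>f X = (\<lambda>p. h p *\<^sub>t X p)"

text \<open>Tangent vectors at \<open>p\<close> are the derivations at \<open>p\<close> of the algebra of smooth functions,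
  extended by 0 to arguments that are not smooth.\<close>

definition tangent_space :: "('a, 'e::euclidean_space) chart set \<Rightarrow> 'a \<Rightarrow> 'a tangent set" where
  "tangent_space A p = {v.
     (\<forall>f. f \<notin> smooth_functions A \<longrightarrow> v f = 0) \<and>
     (\<forall>f\<in>smooth_functions A. \<forall>h\<in>smooth_functions A. v (f + h) = v f + v h) \<and>
     (\<forall>c. \<forall>f\<in>smooth_functions A. v (\<lambda>q. c * f q) = c * v f) \<and>
     (\<forall>f\<in>smooth_functions A. \<forall>h\<in>smooth_functions A. v (f * h) = f p * v h + h p * v f)}"

text \<open>Vector fields vanish by convention outside the manifold, so that equality of vector fields
  is equality of functions.\<close>

definition vector_fields :: "('a, 'e::euclidean_space) chart set \<Rightarrow> 'a field set" where
  "vector_fields A = {X.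
     (\<forall>p\<in>points A. X p \<in> tangent_space A p) \<and>
     (\<forall>p. p \<notin> points A \<longrightarrow> X p = 0) \<and>
     (\<forall>f\<in>smooth_functions A. (\<lambda>p. X p f) \<in> smooth_functions A)}"


subsection \<open>Tensor fields\<close>

text \<open>A tensor field is given by its value at each point, a multilinear map on the tangent space;
  it is smooth if it maps smooth vector fields to a smooth vector field or function.\<close>

definition one_form ::
    "('a, 'e::euclidean_space) chart set \<Rightarrow> ('a \<Rightarrow> 'a tangent \<Rightarrow> real) \<Rightarrow> bool" where
  "one_form A \<alpha> \<longleftrightarrow>
     (\<forall>p\<in>points A. \<forall>v\<in>tangent_space A p. \<forall>w\<in>tangent_space A p. \<alpha> p (v + w) = \<alpha> p v + \<alpha> p w) \<and>
     (\<forall>p\<in>points A. \<forall>v\<in>tangent_space A p. \<forall>c. \<alpha> p (c *\<^sub>t v) = c * \<alpha> p v) \<and>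
     (\<forall>X\<in>vector_fields A. (\<lambda>p. \<alpha> p (X p)) \<in> smooth_functions A)"

definition endo_field ::
    "('a, 'e::euclidean_space) chart set \<Rightarrow> ('a \<Rightarrow> 'a tangent \<Rightarrow> 'a tangent) \<Rightarrow> bool" where
  "endo_field A \<phi> \<longleftrightarrow>
     (\<forall>p\<in>points A. \<forall>v\<in>tangent_space A p. \<phi> p v \<in> tangent_space A p) \<and>
     (\<forall>p\<in>points A. \<forall>v\<in>tangent_space A p. \<forall>w\<in>tangent_space A p. \<phi> p (v + w) = \<phi> p v + \<phi> p w) \<and>
     (\<forall>p\<in>points A. \<forall>v\<in>tangent_space A p. \<forall>c. \<phi> p (c *\<^sub>t v) = c *\<^sub>t \<phi> p v) \<and>
     (\<forall>X\<in>vector_fields A. \<forall>f\<in>smooth_functions A. (\<lambda>p. \<phi> p (X p) f) \<in> smooth_functions A)"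

definition nonsingular ::
    "('a, 'e::euclidean_space) chart set \<Rightarrow> ('a \<Rightarrow> 'a tangent \<Rightarrow> 'a tangent) \<Rightarrow> bool" where
  "nonsingular A Q \<longleftrightarrow> (\<forall>p\<in>points A. bij_betw (Q p) (tangent_space A p) (tangent_space A p))"

definition symmetric_tensor ::
    "('a, 'e::euclidean_space) chart set \<Rightarrow> ('a \<Rightarrow> 'a tangent \<Rightarrow> 'a tangent \<Rightarrow> real) \<Rightarrow> bool" where
  "symmetric_tensor A g \<longleftrightarrow>
     (\<forall>p\<in>points A. \<forall>u\<in>tangent_space A p. \<forall>v\<in>tangent_space A p. g p u v = g p v u) \<and>
     (\<forall>p\<in>points A. \<forall>u\<in>tangent_space A p. \<forall>v\<in>tangent_space A p. \<forall>w\<in>tangent_space A p.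
        g p (u + v) w = g p u w + g p v w) \<and>
     (\<forall>p\<in>points A. \<forall>u\<in>tangent_space A p. \<forall>v\<in>tangent_space A p. \<forall>c.
        g p (c *\<^sub>t u) v = c * g p u v) \<and>
     (\<forall>X\<in>vector_fields A. \<forall>Y\<in>vector_fields A. (\<lambda>p. g p (X p) (Y p)) \<in> smooth_functions A)"

definition nondegenerate ::
    "('a, 'e::euclidean_space) chart set \<Rightarrow> ('a \<Rightarrow> 'a tangent \<Rightarrow> 'a tangent \<Rightarrow> real) \<Rightarrow> bool" where
  "nondegenerate A g \<longleftrightarrow>
     (\<forall>p\<in>points A. \<forall>u\<in>tangent_space A p. (\<forall>v\<in>tangent_space A p. g p u v = 0) \<longrightarrow> u = 0)"

text \<open>The index of \<open>g\<close> at \<open>p\<close> is \<open>\<nu>\<close>: some pseudo-orthonormal basis \<open>e 0, \<dots>, e (m - 1)\<close> of the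
  tangent space, \<open>m\<close> being the dimension of the manifold, has exactly \<open>\<nu>\<close> negative vectors.\<close>

definition has_index ::
    "('a, 'e::euclidean_space) chart set \<Rightarrow> ('a \<Rightarrow> 'a tangent \<Rightarrow> 'a tangent \<Rightarrow> real) \<Rightarrow>
     nat \<Rightarrow> 'a \<Rightarrow> bool" where
  "has_index A g \<nu> p \<longleftrightarrow> \<nu> \<le> DIM('e) \<and>
     (\<exists>e. (\<forall>i<DIM('e). e i \<in> tangent_space A p) \<and>
          (\<forall>v\<in>tangent_space A p. \<exists>c. v = (\<Sum>i<DIM('e). c i *\<^sub>t e i)) \<and>
          (\<forall>i<DIM('e). \<forall>j<DIM('e).
             g p (e i) (e j) = (if i \<noteq> j then 0 else if i < \<nu> then -1 else 1)))"

text \<open>Index 0 is the Riemannian case.\<close>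

definition semi_riemannian_metric ::
    "('a, 'e::euclidean_space) chart set \<Rightarrow> ('a \<Rightarrow> 'a tangent \<Rightarrow> 'a tangent \<Rightarrow> real) \<Rightarrow> bool" where
  "semi_riemannian_metric A g \<longleftrightarrow>
     symmetric_tensor A g \<and> nondegenerate A g \<and> (\<exists>\<nu>. \<forall>p\<in>points A. has_index A g \<nu> p)"


subsection \<open>The Levi-Civita connection\<close>

definition affine_connection ::
    "('a, 'e::euclidean_space) chart set \<Rightarrow> ('a field \<Rightarrow> 'a field \<Rightarrow> 'a field) \<Rightarrow> bool" where
  "affine_connection A D \<longleftrightarrow>
     (\<forall>X\<in>vector_fields A. \<forall>Y\<in>vector_fields A. D X Y \<in> vector_fields A) \<and>
     (\<forall>X\<in>vector_fields A. \<forall>X'\<in>vector_fields A. \<forall>Y\<in>vector_fields A.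
        D (X + X') Y = D X Y + D X' Y) \<and>
     (\<forall>h\<in>smooth_functions A. \<forall>X\<in>vector_fields A. \<forall>Y\<in>vector_fields A.
        D (h *\<^sub>f X) Y = h *\<^sub>f D X Y) \<and>
     (\<forall>X\<in>vector_fields A. \<forall>Y\<in>vector_fields A. \<forall>Y'\<in>vector_fields A.
        D X (Y + Y') = D X Y + D X Y') \<and>
     (\<forall>h\<in>smooth_functions A. \<forall>X\<in>vector_fields A. \<forall>Y\<in>vector_fields A.
        D X (h *\<^sub>f Y) = (\<lambda>p. X p h) *\<^sub>f Y + h *\<^sub>f D X Y)"

text \<open>Both sides of the equation are applied to a smooth function \<open>f\<close>: the right-hand side is
  the Lie bracket.\<close>

definition torsion_free ::
    "('a, 'e::euclidean_space) chart set \<Rightarrow> ('a field \<Rightarrow> 'a field \<Rightarrow> 'a field) \<Rightarrow> bool" where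
  "torsion_free A D \<longleftrightarrow>
     (\<forall>X\<in>vector_fields A. \<forall>Y\<in>vector_fields A. \<forall>f\<in>smooth_functions A. \<forall>p\<in>points A.
        D X Y p f - D Y X p f = X p (\<lambda>q. Y q f) - Y p (\<lambda>q. X q f))"

definition metric_connection ::
    "('a, 'e::euclidean_space) chart set \<Rightarrow> ('a \<Rightarrow> 'a tangent \<Rightarrow> 'a tangent \<Rightarrow> real) \<Rightarrow>
     ('a field \<Rightarrow> 'a field \<Rightarrow> 'a field) \<Rightarrow> bool" where
  "metric_connection A g D \<longleftrightarrow>
     (\<forall>X\<in>vector_fields A. \<forall>Y\<in>vector_fields A. \<forall>Z\<in>vector_fields A. \<forall>p\<in>points A.
        X p (\<lambda>q. g q (Y q) (Z q)) = g p (D X Y p) (Z p) + g p (Y p) (D X Z p))"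

definition levi_civita_connection ::
    "('a, 'e::euclidean_space) chart set \<Rightarrow> ('a \<Rightarrow> 'a tangent \<Rightarrow> 'a tangent \<Rightarrow> real) \<Rightarrow>
     ('a field \<Rightarrow> 'a field \<Rightarrow> 'a field) \<Rightarrow> bool" where
  "levi_civita_connection A g D \<longleftrightarrow>
     affine_connection A D \<and> torsion_free A D \<and> metric_connection A g D"


subsection \<open>Weak almost contact B-metric structures\<close>

definition kernel_distribution ::
    "('a, 'e::euclidean_space) chart set \<Rightarrow> ('a \<Rightarrow> 'a tangent \<Rightarrow> real) \<Rightarrow> 'a \<Rightarrow> 'a tangent set" where
  "kernel_distribution A \<eta> p = {v \<in> tangent_space A p. \<eta> p v = 0}"

definition sections ::
    "('a, 'e::euclidean_space) chart set \<Rightarrow> ('a \<Rightarrow> 'a tangent set) \<Rightarrow> 'a field set" where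
  "sections A \<D> = {X \<in> vector_fields A. \<forall>p\<in>points A. X p \<in> \<D> p}"

definition weak_almost_contact ::
    "('a, 'e::euclidean_space) chart set \<Rightarrow> ('a \<Rightarrow> 'a tangent \<Rightarrow> 'a tangent) \<Rightarrow>
     ('a \<Rightarrow> 'a tangent \<Rightarrow> 'a tangent) \<Rightarrow> 'a field \<Rightarrow> ('a \<Rightarrow> 'a tangent \<Rightarrow> real) \<Rightarrow> bool" where
  "weak_almost_contact A \<phi> Q \<xi> \<eta> \<longleftrightarrow>
     endo_field A \<phi> \<and> endo_field A Q \<and> nonsingular A Q \<and> \<xi> \<in> vector_fields A \<and> one_form A \<eta> \<and>
     (\<forall>p\<in>points A. \<forall>v\<in>tangent_space A p. \<phi> p (\<phi> p v) = - Q p v + \<eta> p v *\<^sub>t \<xi> p) \<and>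
     (\<forall>p\<in>points A. \<eta> p (\<xi> p) = 1) \<and>
     (\<forall>p\<in>points A. Q p (\<xi> p) = \<xi> p) \<and>
     (\<forall>p\<in>points A. \<phi> p ` kernel_distribution A \<eta> p \<subseteq> kernel_distribution A \<eta> p)"

definition weak_almost_contact_B_metric ::
    "('a, 'e::euclidean_space) chart set \<Rightarrow> ('a \<Rightarrow> 'a tangent \<Rightarrow> 'a tangent) \<Rightarrow>
     ('a \<Rightarrow> 'a tangent \<Rightarrow> 'a tangent) \<Rightarrow> 'a field \<Rightarrow> ('a \<Rightarrow> 'a tangent \<Rightarrow> real) \<Rightarrow>
     ('a \<Rightarrow> 'a tangent \<Rightarrow> 'a tangent \<Rightarrow> real) \<Rightarrow> bool" where
  "weak_almost_contact_B_metric A \<phi> Q \<xi> \<eta> g \<longleftrightarrow>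
     weak_almost_contact A \<phi> Q \<xi> \<eta> \<and> semi_riemannian_metric A g \<and>
     (\<forall>X\<in>vector_fields A. \<forall>Y\<in>vector_fields A. \<forall>p\<in>points A.
        g p (\<phi> p (X p)) (\<phi> p (Y p)) = - g p (X p) (Q p (Y p)) + \<eta> p (X p) * \<eta> p (Y p))"


subsection \<open>Parallel objects\<close>

definition parallel_distribution ::
    "('a, 'e::euclidean_space) chart set \<Rightarrow> ('a field \<Rightarrow> 'a field \<Rightarrow> 'a field) \<Rightarrow>
     ('a \<Rightarrow> 'a tangent set) \<Rightarrow> bool" where
  "parallel_distribution A D \<D> \<longleftrightarrow>
     (\<forall>X\<in>vector_fields A. \<forall>Y\<in>sections A \<D>. D X Y \<in> sections A \<D>)"

definition covariant_derivative_form ::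
    "('a field \<Rightarrow> 'a field \<Rightarrow> 'a field) \<Rightarrow> ('a \<Rightarrow> 'a tangent \<Rightarrow> real) \<Rightarrow>
     'a field \<Rightarrow> 'a field \<Rightarrow> 'a \<Rightarrow> real" where
  "covariant_derivative_form D \<alpha> X Y p = X p (\<lambda>q. \<alpha> q (Y q)) - \<alpha> p (D X Y p)"

definition parallel_form ::
    "('a, 'e::euclidean_space) chart set \<Rightarrow> ('a field \<Rightarrow> 'a field \<Rightarrow> 'a field) \<Rightarrow>
     ('a \<Rightarrow> 'a tangent \<Rightarrow> real) \<Rightarrow> bool" where
  "parallel_form A D \<alpha> \<longleftrightarrow>
     (\<forall>X\<in>vector_fields A. \<forall>Y\<in>vector_fields A. \<forall>p\<in>points A.
        covariant_derivative_form D \<alpha> X Y p = 0)"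

definition parallel_field ::
    "('a, 'e::euclidean_space) chart set \<Rightarrow> ('a field \<Rightarrow> 'a field \<Rightarrow> 'a field) \<Rightarrow>
     'a field \<Rightarrow> bool" where
  "parallel_field A D Z \<longleftrightarrow> (\<forall>X\<in>vector_fields A. D X Z = 0)"

end

theory Submission
  imports Defs
begin

text \<open>
  The structure forces \<open>\<eta>\<close> to be the metric dual of \<open>\<xi>\<close>. Indeed \<open>\<phi> \<xi> = 0\<close>
  (\<open>structure_endomorphism_kills_Reeb\<close>), so the compatibility of \<open>g\<close> with \<open>\<phi>\<close>, taken at the pair
  \<open>X, \<xi>\<close>, becomes \<open>0 = - g(X, \<xi>) + \<eta>(X)\<close> (\<open>contact_form_is_metric_dual_of_Reeb\<close>).
  A metric connection commutes with this duality:
  \<open>(\<nabla>\<^sub>X \<eta>)(Y) = X g(Y, \<xi>) - g(\<nabla>\<^sub>X Y, \<xi>) = g(Y, \<nabla>\<^sub>X \<xi>)\<close>.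
  Together with nondegeneracy this is the equivalence of \<open>\<nabla>\<eta> = 0\<close> and \<open>\<nabla>\<xi> = 0\<close>.

  For \<open>Y\<close> in the contact distribution, \<open>\<eta>(\<nabla>\<^sub>X Y) = - (\<nabla>\<^sub>X \<eta>)(Y)\<close>, so the distribution is parallel
  exactly when \<open>\<nabla>\<^sub>X \<eta>\<close> vanishes on it. The remaining direction costs nothing: \<open>g(\<xi>, \<xi>) = 1\<close> is
  constant, whence \<open>(\<nabla>\<^sub>X \<eta>)(\<xi>) = g(\<xi>, \<nabla>\<^sub>X \<xi>) = 0\<close>, and every field is the sum of a section of the
  distribution and a multiple of \<open>\<xi>\<close>.

  The analytic content hides in the words ``together with nondegeneracy''. Parallelism tests
  \<open>\<nabla>\<^sub>X \<xi>\<close> at \<open>p\<close> against the values at \<open>p\<close> of global vector fields, nondegeneracy tests it against all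
  tangent vectors at \<open>p\<close>; so each tangent vector has to extend to a global vector field
  (\<open>tangent_vector_extends\<close>). The extension is a coordinate field multiplied by a bump function.
  That the coordinate vectors exhaust the derivations at \<open>p\<close> would usually be read off a Taylor
  expansion; here a pseudo-orthonormal basis bounds the dimension of the tangent space by that of the
  model space, and the coordinate vectors, being independent, fill it for dimensional reasons.
\<close>

section \<open>Calculus of smooth maps\<close>

lemma differentiable_up_to_cong:
  assumes "open S" and "\<And>x. x \<in> S \<Longrightarrow> f x = h x" and "differentiable_up_to k S f"
  shows "differentiable_up_to k S h"
  using assms(2,3)
proof (induction k arbitrary: f h)
  case 0
  then show ?case by (simp cong: continuous_on_cong)
next
  case (Suc k)
  have *: "(h has_derivative frechet_derivative f (at x)) (at x)" if "x \<in> S" for x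
    using Suc.prems that assms(1)
    by (metis differentiable_up_to.simps(2) frechet_derivative_works has_derivative_transform_within_open)
  then have "frechet_derivative f (at x) = frechet_derivative h (at x)" if "x \<in> S" for x
    using that by (blast intro: frechet_derivative_at)
  then have "differentiable_up_to k S (\<lambda>x. frechet_derivative h (at x) v)" for v
    using Suc.IH[of "\<lambda>x. frechet_derivative f (at x) v" "\<lambda>x. frechet_derivative h (at x) v"]
      Suc.prems(2) by simp
  then show ?case using * by (auto simp: differentiable_def)
qed

lemma differentiable_up_to_subset:
  "differentiable_up_to k S f \<Longrightarrow> R \<subseteq> S \<Longrightarrow> differentiable_up_to k R f"
  by (induction k arbitrary: f) (auto intro: continuous_on_subset)

lemma differentiable_up_to_Suc_imp:
  "differentiable_up_to (Suc k) S f \<Longrightarrow> differentiable_up_to k S f"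
proof (induction k arbitrary: f)
  case 0
  then show ?case
    by (auto intro!: continuous_at_imp_continuous_on differentiable_imp_continuous_within)
next
  case (Suc k)
  then show ?case by (metis differentiable_up_to.simps(2))
qed

lemma differentiable_up_to_local:
  assumes "\<And>x. x \<in> S \<Longrightarrow> \<exists>N. open N \<and> x \<in> N \<and> differentiable_up_to k N f"
  shows "differentiable_up_to k S f"
  using assms
proof (induction k arbitrary: f)
  case 0
  then show ?case
    by (auto intro!: continuous_at_imp_continuous_on) (metis continuous_on_eq_continuous_at)
next
  case (Suc k)
  have "differentiable_up_to k S (\<lambda>x. frechet_derivative f (at x) v)" for v
    using Suc.prems by (intro Suc.IH) (metis differentiable_up_to.simps(2))
  then show ?case using Suc.prems by fastforce
qed

lemma differentiable_up_to_const: "differentiable_up_to k S (\<lambda>_. c)"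
  by (induction k arbitrary: c) (auto simp: frechet_derivative_const)

text \<open>Replaces \<open>frechet_derivative\<close> by any explicit formula for the derivative, which turns each
  closure property below into an induction on the order with the usual derivative rule as its step.\<close>

lemma differentiable_up_to_SucI:
  assumes "open S"
    and "\<And>x. x \<in> S \<Longrightarrow> (f has_derivative f' x) (at x)"
    and "\<And>v. differentiable_up_to k S (\<lambda>x. f' x v)"
  shows "differentiable_up_to (Suc k) S f"
proof -
  have "f' x = frechet_derivative f (at x)" if "x \<in> S" for x
    using assms(2) that by (blast intro: frechet_derivative_at)
  then have "differentiable_up_to k S (\<lambda>x. frechet_derivative f (at x) v)" for v
    using differentiable_up_to_cong[OF assms(1) _ assms(3)[of v]] by simp
  then show ?thesis
    using assms(2) by (auto simp: differentiable_def)
qed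

lemma differentiable_up_to_has_derivative:
  assumes "differentiable_up_to (Suc k) S f" and "x \<in> S"
  shows "(f has_derivative frechet_derivative f (at x)) (at x)"
  using assms by (auto simp: frechet_derivative_works[symmetric])

lemma differentiable_up_to_linear:
  assumes "bounded_linear L" and "open S"
  shows "differentiable_up_to k S f \<Longrightarrow> differentiable_up_to k S (\<lambda>x. L (f x))"
proof (induction k arbitrary: f)
  case 0
  then show ?case using assms by (simp add: bounded_linear.continuous_on)
next
  case (Suc k)
  show ?case
    using Suc differentiable_up_to_has_derivative[OF Suc.prems] assms
    by (intro differentiable_up_to_SucI[where f' = "\<lambda>x v. L (frechet_derivative f (at x) v)"])
      (auto intro: bounded_linear.has_derivative)
qed

lemma differentiable_up_to_add:
  assumes "open S"
  shows "differentiable_up_to k S f \<Longrightarrow> differentiable_up_to k S h \<Longrightarrow>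
    differentiable_up_to k S (\<lambda>x. f x + h x)"
proof (induction k arbitrary: f h)
  case 0
  then show ?case by (simp add: continuous_on_add)
next
  case (Suc k)
  show ?case
    using Suc differentiable_up_to_has_derivative[OF Suc.prems(1)]
      differentiable_up_to_has_derivative[OF Suc.prems(2)] assms
    by (intro differentiable_up_to_SucI[where f' =
          "\<lambda>x v. frechet_derivative f (at x) v + frechet_derivative h (at x) v"])
      (auto intro: has_derivative_add)
qed

lemma differentiable_up_to_sum:
  assumes "open S" and "\<And>i. i \<in> I \<Longrightarrow> differentiable_up_to k S (f i)"
  shows "differentiable_up_to k S (\<lambda>x. \<Sum>i\<in>I. f i x)"
  using assms(2)
  by (induction I rule: infinite_finite_induct)
    (auto intro: differentiable_up_to_add[OF assms(1)] differentiable_up_to_const)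

lemma differentiable_up_to_mult:
  fixes f h :: "'e::real_normed_vector \<Rightarrow> real"
  assumes "open S"
  shows "differentiable_up_to k S f \<Longrightarrow> differentiable_up_to k S h \<Longrightarrow>
    differentiable_up_to k S (\<lambda>x. f x * h x)"
proof (induction k arbitrary: f h)
  case 0
  then show ?case by (simp add: continuous_on_mult)
next
  case (Suc k)
  note prems = Suc.prems Suc.prems[THEN differentiable_up_to_Suc_imp]
  show ?case
  proof (rule differentiable_up_to_SucI[OF assms])
    fix x assume "x \<in> S"
    then show "((\<lambda>x. f x * h x) has_derivative
      (\<lambda>v. f x * frechet_derivative h (at x) v + frechet_derivative f (at x) v * h x)) (at x)"
      using prems differentiable_up_to_has_derivative by (blast intro: has_derivative_mult)
  next
    fix v
    show "differentiable_up_to k S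
      (\<lambda>x. f x * frechet_derivative h (at x) v + frechet_derivative f (at x) v * h x)"
      using prems by (auto intro!: differentiable_up_to_add[OF assms] Suc.IH)
  qed
qed

text \<open>The derivative of \<open>f \<circ> t\<close> in a direction \<open>v\<close> must be rewritten as a sum of products of functions
  of the lower order. Expanding the direction \<open>t'(x) v\<close> in the standard basis does this, since each
  partial derivative of \<open>f\<close> is taken in a direction independent of \<open>x\<close>.\<close>

lemma differentiable_up_to_compose:
  fixes f :: "'d::euclidean_space \<Rightarrow> real" and t :: "'e::real_normed_vector \<Rightarrow> 'd"
  assumes "open S" and "t ` S \<subseteq> R"
  shows "differentiable_up_to k R f \<Longrightarrow> differentiable_up_to k S t \<Longrightarrow>
    differentiable_up_to k S (\<lambda>x. f (t x))"
proof (induction k arbitrary: f)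
  case 0
  then show ?case using assms by (auto intro: continuous_on_compose2)
next
  case (Suc k)
  note t = Suc.prems(2) Suc.prems(2)[THEN differentiable_up_to_Suc_imp]
  show ?case
  proof (rule differentiable_up_to_SucI[OF assms(1)])
    fix x assume x: "x \<in> S"
    have f': "(f has_derivative frechet_derivative f (at (t x))) (at (t x))"
      by (rule differentiable_up_to_has_derivative[OF Suc.prems(1)]) (use x assms(2) in auto)
    have t': "(t has_derivative frechet_derivative t (at x)) (at x)"
      by (rule differentiable_up_to_has_derivative[OF Suc.prems(2) x])
    have sum: "frechet_derivative f (at (t x)) w =
      (\<Sum>b\<in>Basis. (w \<bullet> b) * frechet_derivative f (at (t x)) b)" for w
      using Linear_Algebra.linear_componentwise[OF has_derivative_linear[OF f'], of w 1] by simp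
    show "((\<lambda>x. f (t x)) has_derivative (\<lambda>v. \<Sum>b\<in>Basis.
        (frechet_derivative t (at x) v \<bullet> b) * frechet_derivative f (at (t x)) b)) (at x)"
      using diff_chain_at[OF t' f'] by (simp only: o_def sum[symmetric])
  next
    fix v
    show "differentiable_up_to k S (\<lambda>x. \<Sum>b\<in>Basis.
        (frechet_derivative t (at x) v \<bullet> b) * frechet_derivative f (at (t x)) b)"
    proof (intro differentiable_up_to_sum differentiable_up_to_mult assms(1))
      fix b :: 'd
      show "differentiable_up_to k S (\<lambda>x. frechet_derivative t (at x) v \<bullet> b)"
        using Suc.prems(2) assms(1)
        by (simp add: differentiable_up_to_linear[OF bounded_linear_inner_left])
      show "differentiable_up_to k S (\<lambda>x. frechet_derivative f (at (t x)) b)"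
        using Suc.prems(1) t(2) Suc.IH[of "\<lambda>y. frechet_derivative f (at y) b"] by simp
    qed
  qed
qed

lemma smooth_on_derivative:
  "smooth_on S f \<Longrightarrow> smooth_on S (\<lambda>x. frechet_derivative f (at x) v)"
  unfolding smooth_on_def by (metis differentiable_up_to.simps(2))

lemma smooth_on_differentiable:
  "smooth_on S f \<Longrightarrow> x \<in> S \<Longrightarrow> f differentiable (at x)"
  unfolding smooth_on_def by (metis differentiable_up_to.simps(2))

lemma smooth_on_cong:
  "open S \<Longrightarrow> (\<And>x. x \<in> S \<Longrightarrow> f x = h x) \<Longrightarrow> smooth_on S f \<longleftrightarrow> smooth_on S h"
  unfolding smooth_on_def using differentiable_up_to_cong[of S] by metis

lemma smooth_on_subset: "smooth_on S f \<Longrightarrow> R \<subseteq> S \<Longrightarrow> smooth_on R f"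
  unfolding smooth_on_def using differentiable_up_to_subset by blast

lemma smooth_on_local:
  assumes "\<And>x. x \<in> S \<Longrightarrow> \<exists>N. open N \<and> x \<in> N \<and> smooth_on N f"
  shows "smooth_on S f"
  unfolding smooth_on_def
  using assms[unfolded smooth_on_def] by (intro allI differentiable_up_to_local) blast

lemma smooth_on_const: "smooth_on S (\<lambda>_. c)"
  by (simp add: smooth_on_def differentiable_up_to_const)

lemma smooth_on_add:
  "open S \<Longrightarrow> smooth_on S f \<Longrightarrow> smooth_on S h \<Longrightarrow> smooth_on S (\<lambda>x. f x + h x)"
  by (simp add: smooth_on_def differentiable_up_to_add)

lemma smooth_on_mult:
  fixes f h :: "'e::real_normed_vector \<Rightarrow> real"
  shows "open S \<Longrightarrow> smooth_on S f \<Longrightarrow> smooth_on S h \<Longrightarrow> smooth_on S (\<lambda>x. f x * h x)"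
  by (simp add: smooth_on_def differentiable_up_to_mult)

lemma smooth_on_compose:
  fixes f :: "'d::euclidean_space \<Rightarrow> real" and t :: "'e::real_normed_vector \<Rightarrow> 'd"
  shows "open S \<Longrightarrow> t ` S \<subseteq> R \<Longrightarrow> smooth_on R f \<Longrightarrow> smooth_on S t \<Longrightarrow>
    smooth_on S (\<lambda>x. f (t x))"
  by (simp add: smooth_on_def differentiable_up_to_compose)

lemma smooth_on_linear_minus_const:
  fixes L :: "'e::real_normed_vector \<Rightarrow> real"
  assumes "bounded_linear L"
  shows "smooth_on UNIV (\<lambda>x. L x - c)"
proof -
  have "differentiable_up_to k UNIV (\<lambda>x. L x - c)" for k
  proof (cases k)
    case 0
    then show ?thesis
      using bounded_linear.continuous_on[OF assms continuous_on_id]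
      by (auto intro!: continuous_on_diff)
  next
    case (Suc l)
    have "((\<lambda>x. L x - c) has_derivative L) (at x)" for x
      using assms by (auto intro!: derivative_eq_intros bounded_linear_imp_has_derivative)
    then show ?thesis
      unfolding Suc by (intro differentiable_up_to_SucI[where f' = "\<lambda>_. L"])
        (auto intro: differentiable_up_to_const)
  qed
  then show ?thesis by (simp add: smooth_on_def)
qed

section \<open>Bump functions\<close>

text \<open>The powers of \<open>t\<close> in the denominator make the span of these functions closed under
  differentiation, so that the smoothness of all of them is a single induction.\<close>

definition flat_function :: "nat \<Rightarrow> real \<Rightarrow> real" where
  "flat_function n t = (if t > 0 then exp (- 1 / t) / t ^ n else 0)"

lemma flat_function_tendsto_0: "(flat_function n \<longlongrightarrow> 0) (at 0)"
proof -
  \<comment> \<open>Substituting \<open>s = 1 / t\<close> leaves a power against an exponential at infinity.\<close>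
  have "((\<lambda>s::real. s ^ n / exp s) \<longlongrightarrow> 0) at_top"
    by (rule tendsto_power_div_exp_0)
  then have "((\<lambda>t::real. inverse t ^ n / exp (inverse t)) \<longlongrightarrow> 0) (at_right 0)"
    by (rule filterlim_compose[OF _ filterlim_inverse_at_top_right])
  then have "(flat_function n \<longlongrightarrow> 0) (at_right 0)"
    by (rule Lim_transform_eventually)
      (auto simp: flat_function_def eventually_at_filter exp_minus field_simps)
  moreover have "(flat_function n \<longlongrightarrow> 0) (at_left 0)"
    by (rule tendsto_eventually) (auto simp: flat_function_def eventually_at_filter)
  ultimately show ?thesis by (simp add: filterlim_split_at)
qed

lemma has_real_derivative_flat_function:
  "(flat_function n has_real_derivative
    flat_function (n + 2) t - real n * flat_function (n + 1) t) (at t)"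
proof -
  consider "t < 0" | "t = 0" | "t > 0" by linarith
  then show ?thesis
  proof cases
    case 1
    have "((\<lambda>_. 0::real) has_real_derivative 0) (at t)" by simp
    then have "(flat_function n has_real_derivative 0) (at t)"
      by (rule has_field_derivative_transform_within_open[of _ _ _ "{..<0}"])
        (use 1 in \<open>auto simp: flat_function_def\<close>)
    then show ?thesis using 1 by (simp add: flat_function_def)
  next
    case 2
    \<comment> \<open>The difference quotient at 0 is itself the next flat function.\<close>
    have "((\<lambda>t. (flat_function n t - flat_function n 0) / (t - 0)) \<longlongrightarrow> 0) (at 0)"
      using flat_function_tendsto_0[of "n + 1"]
      by (rule Lim_transform_eventually)
        (auto simp: flat_function_def eventually_at_filter field_simps)
    then show ?thesis
      using 2 by (simp add: has_field_derivative_iff flat_function_def)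
  next
    case 3
    have "((\<lambda>t. exp (- 1 / t) / t ^ n) has_real_derivative
       exp (- 1 / t) / t ^ (n + 2) - n * (exp (- 1 / t) / t ^ (n + 1))) (at t)"
    proof (cases n)
      case 0
      show ?thesis
        unfolding 0 using 3 by (auto intro!: derivative_eq_intros simp: field_simps power2_eq_square)
    next
      case (Suc m)
      have "real n * t ^ (n - 1) * t ^ 2 = real n * t ^ (n + 1)"
        by (simp add: Suc power2_eq_square)
      then show ?thesis
        using 3 by (auto intro!: derivative_eq_intros simp: field_simps power2_eq_square)
    qed
    then have "((flat_function n) has_real_derivative
       exp (- 1 / t) / t ^ (n + 2) - n * (exp (- 1 / t) / t ^ (n + 1))) (at t)"
      by (rule has_field_derivative_transform_within_open[of _ _ _ "{0<..}"])
        (use 3 in \<open>auto simp: flat_function_def\<close>)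
    then show ?thesis using 3 by (simp add: flat_function_def)
  qed
qed

lemma smooth_on_flat_function: "smooth_on UNIV (flat_function n)"
proof -
  have "differentiable_up_to k UNIV (flat_function n)" for k
  proof (induction k arbitrary: n)
    case 0
    then show ?case
      using has_real_derivative_flat_function
      by (auto intro!: continuous_at_imp_continuous_on intro: DERIV_isCont)
  next
    case (Suc k)
    show ?case
    proof (rule differentiable_up_to_SucI)
      show "(flat_function n has_derivative
        (\<lambda>v. (flat_function (n + 2) t + (- real n) * flat_function (n + 1) t) * v)) (at t)" for t
        using has_real_derivative_flat_function[of n t]
        by (simp add: has_field_derivative_def)
      show "differentiable_up_to k UNIV
        (\<lambda>t. (flat_function (n + 2) t + (- real n) * flat_function (n + 1) t) * v)" for v
        by (intro differentiable_up_to_mult differentiable_up_to_add differentiable_up_to_const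
            Suc.IH open_UNIV)
    qed simp
  qed
  then show ?thesis by (simp add: smooth_on_def)
qed

text \<open>The bump is a flat function of \<open>r\<^sup>2 - |z - a|\<^sup>2\<close>, rescaled at the centre.\<close>

lemma smooth_bump_exists:
  fixes a :: "'e::euclidean_space"
  assumes "r > 0"
  obtains \<beta> :: "'e \<Rightarrow> real"
  where "smooth_on UNIV \<beta>" and "\<beta> a = 1" and "\<And>z. z \<notin> ball a r \<Longrightarrow> \<beta> z = 0"
proof
  define q where "q z = r\<^sup>2 + (- 1) * (\<Sum>b\<in>Basis. (z \<bullet> b - a \<bullet> b) * (z \<bullet> b - a \<bullet> b))" for z :: 'e
  define \<beta> where "\<beta> z = exp (1 / r\<^sup>2) * flat_function 0 (q z)" for z
  have sq: "smooth_on UNIV (\<lambda>z::'e. z \<bullet> b - a \<bullet> b)" for b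
    by (intro smooth_on_linear_minus_const bounded_linear_inner_left)
  have "smooth_on UNIV q"
    unfolding q_def smooth_on_def
    using sq by (intro allI differentiable_up_to_add differentiable_up_to_mult
        differentiable_up_to_const differentiable_up_to_sum open_UNIV) (auto simp: smooth_on_def)
  then show "smooth_on UNIV \<beta>"
    unfolding \<beta>_def
    by (intro smooth_on_mult smooth_on_const smooth_on_compose[OF _ _ smooth_on_flat_function]) auto
  have q: "q z = r\<^sup>2 - (dist a z)\<^sup>2" for z
    unfolding q_def dist_norm norm_eq_sqrt_inner[of "a - z"] real_sqrt_pow2[OF inner_ge_zero]
    by (subst euclidean_inner)
      (simp add: inner_diff_left algebra_simps)
  show "\<beta> a = 1"
    using assms by (simp add: \<beta>_def flat_function_def q exp_minus)
  show "\<beta> z = 0" if "z \<notin> ball a r" for z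
    using that assms by (simp add: \<beta>_def flat_function_def q power_mono not_less)
qed


section \<open>Charts and smooth functions\<close>

lemma chart_facts:
  assumes "smooth_manifold T A" and "(U, x) \<in> A"
  shows "openin T U" and "open (x ` U)" and "inj_on x U" and "U \<subseteq> points A"
    and "homeomorphic_map (subtopology T U) (top_of_set (x ` U)) x"
    and "topspace (subtopology T U) = U"
proof -
  have c: "is_chart T (U, x)" using assms by (auto simp: smooth_manifold_def)
  then show U: "openin T U" and "open (x ` U)"
    and h: "homeomorphic_map (subtopology T U) (top_of_set (x ` U)) x"
    by (auto simp: is_chart_def)
  show *: "topspace (subtopology T U) = U"
    using openin_subset[OF U] by auto
  show "inj_on x U"
    using homeomorphic_imp_injective_map[OF h] unfolding * .
  show "U \<subseteq> points A" using assms by (force simp: points_def)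
qed

lemma chart_open_image:
  assumes "smooth_manifold T A" and "(U, x) \<in> A" and "openin T W" and "W \<subseteq> U"
  shows "open (x ` W)"
proof -
  note c = chart_facts[OF assms(1,2)]
  have "openin (subtopology T U) W"
    using assms(3,4) c(1) openin_open_subtopology by blast
  then have "openin (top_of_set (x ` U)) (x ` W)"
    using homeomorphic_imp_open_map[OF c(5)] by (simp add: open_map_def)
  then show ?thesis using c(2) openin_open_trans by blast
qed

text \<open>This is where the Hausdorff property enters: without it a function with compact support in a
  chart need not extend continuously by zero.\<close>

lemma chart_compact_preimage_closed:
  assumes "smooth_manifold T A" and "(U, x) \<in> A" and "compact C" and "C \<subseteq> x ` U"
  shows "closedin T {q \<in> U. x q \<in> C}"
proof -
  note c = chart_facts[OF assms(1,2)]
  let ?K = "{q \<in> U. x q \<in> C}"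
  have "x ` ?K = C" using assms(4) by auto
  then have "compactin (subtopology T U) ?K"
    using homeomorphic_map_compactness[OF c(5), of ?K] c(6) assms(3,4)
    by (auto simp: compactin_subtopology)
  then show ?thesis
    using assms(1) by (auto simp: compactin_subtopology smooth_manifold_def
        intro: compactin_imp_closedin)
qed

lemma smooth_functions_iff:
  "f \<in> smooth_functions A \<longleftrightarrow> (\<forall>(U, x)\<in>A. smooth_on (x ` U) (\<lambda>z. f (inv_into U x z)))"
  by (auto simp: smooth_functions_def o_def)

lemma smooth_function_in_chart:
  "f \<in> smooth_functions A \<Longrightarrow> (U, x) \<in> A \<Longrightarrow> smooth_on (x ` U) (f \<circ> inv_into U x)"
  by (auto simp: smooth_functions_def)

lemma smooth_functions_const: "(\<lambda>_. c) \<in> smooth_functions A"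
  by (auto simp: smooth_functions_iff smooth_on_const)

lemma smooth_functions_add:
  assumes "smooth_manifold T A" and "f \<in> smooth_functions A" and "h \<in> smooth_functions A"
  shows "(\<lambda>q. f q + h q) \<in> smooth_functions A"
  using assms chart_facts(2)[OF assms(1)] by (fastforce simp: smooth_functions_iff intro: smooth_on_add)

lemma smooth_functions_mult:
  assumes "smooth_manifold T A" and "f \<in> smooth_functions A" and "h \<in> smooth_functions A"
  shows "(\<lambda>q. f q * h q) \<in> smooth_functions A"
  using assms chart_facts(2)[OF assms(1)] by (fastforce simp: smooth_functions_iff intro: smooth_on_mult)

lemma smooth_functions_cong:
  assumes "smooth_manifold T A" and "f \<in> smooth_functions A"
    and "\<And>q. q \<in> points A \<Longrightarrow> f q = h q"
  shows "h \<in> smooth_functions A"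
  unfolding smooth_functions_iff
proof safe
  fix U x assume c: "(U, x) \<in> A"
  have "f (inv_into U x z) = h (inv_into U x z)" if "z \<in> x ` U" for z
    using inv_into_into[OF that] chart_facts(4)[OF assms(1) c] assms(3) by auto
  moreover have "smooth_on (x ` U) (\<lambda>z. f (inv_into U x z))"
    using assms(2) c by (auto simp: smooth_functions_iff)
  ultimately show "smooth_on (x ` U) (\<lambda>z. h (inv_into U x z))"
    by (subst smooth_on_cong[OF chart_facts(2)[OF assms(1) c], symmetric]) auto
qed

text \<open>In another chart \<open>(V, y)\<close> the extension is \<open>G\<close> composed with the transition map on the image of
  the overlap with \<open>U\<close>, and it is zero on the image of the complement of the support; these two open
  sets cover the image of \<open>V\<close>.\<close>

lemma smooth_extension_by_zero:
  fixes A :: "('a, 'e::euclidean_space) chart set" and G :: "'e \<Rightarrow> real"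
  assumes M: "smooth_manifold T A" and c: "(U, x) \<in> A" and G: "smooth_on (x ` U) G"
    and C: "compact C" "C \<subseteq> x ` U" and zero: "\<And>z. z \<in> x ` U \<Longrightarrow> z \<notin> C \<Longrightarrow> G z = 0"
  shows "(\<lambda>q. if q \<in> U then G (x q) else 0) \<in> smooth_functions A"
  unfolding smooth_functions_iff
proof safe
  fix V y assume d: "(V, y) \<in> A"
  note U = chart_facts[OF M c] and V = chart_facts[OF M d]
  let ?F = "\<lambda>q. if q \<in> U then G (x q) else 0" and ?K = "{q \<in> U. x q \<in> C}"
  show "smooth_on (y ` V) (\<lambda>z. ?F (inv_into V y z))"
  proof (rule smooth_on_local)
    fix z assume z: "z \<in> y ` V"
    let ?q = "inv_into V y z"
    show "\<exists>N. open N \<and> z \<in> N \<and> smooth_on N (\<lambda>z. ?F (inv_into V y z))"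
    proof (cases "?q \<in> U")
      case True
      let ?N = "y ` (V \<inter> U)"
      have op: "open ?N"
        using chart_open_image[OF M d] U(1) V(1) by blast
      have zN: "z \<in> ?N" using True imageI[of ?q "V \<inter> U" y] by (simp add: f_inv_into_f[OF z] inv_into_into[OF z])
      have "smooth_transition (V, y) (U, x)"
        using M c d by (auto simp: smooth_manifold_def)
      then have tr: "smooth_on ?N (\<lambda>z. x (inv_into V y z))"
        by (simp add: smooth_transition_def o_def)
      have inU: "inv_into V y w \<in> U" if "w \<in> ?N" for w
        using that V(3) by auto
      have "smooth_on ?N (\<lambda>z. G (x (inv_into V y z)))"
        using inU by (intro smooth_on_compose[OF op _ G tr]) auto
      then have "smooth_on ?N (\<lambda>z. ?F (inv_into V y z))"
        by (subst smooth_on_cong[OF op]) (auto simp: V(3))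
      then show ?thesis using op zN by blast
    next
      case False
      let ?N = "y ` (V - ?K)"
      have "openin T (V - ?K)"
        using chart_compact_preimage_closed[OF M c C] V(1) by blast
      then have op: "open ?N"
        using chart_open_image[OF M d] by blast
      have zN: "z \<in> ?N" using False imageI[of ?q "V - ?K" y] by (simp add: f_inv_into_f[OF z] inv_into_into[OF z])
      have "smooth_on ?N (\<lambda>_. 0 :: real)" by (rule smooth_on_const)
      then have "smooth_on ?N (\<lambda>z. ?F (inv_into V y z))"
        using V(3) by (subst smooth_on_cong[OF op, of _ "\<lambda>_. 0"]) (auto intro!: zero)
      then show ?thesis using op zN by blast
    qed
  qed
qed

section \<open>Tangent vectors and vector fields\<close>

lemma tangent_add:
  "v \<in> tangent_space A p \<Longrightarrow> f \<in> smooth_functions A \<Longrightarrow> h \<in> smooth_functions A \<Longrightarrow>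
    v (\<lambda>q. f q + h q) = v f + v h"
  by (auto simp: tangent_space_def plus_fun_def)

lemma tangent_cmult:
  "v \<in> tangent_space A p \<Longrightarrow> f \<in> smooth_functions A \<Longrightarrow> v (\<lambda>q. c * f q) = c * v f"
  by (auto simp: tangent_space_def)

lemma tangent_Leibniz:
  "v \<in> tangent_space A p \<Longrightarrow> f \<in> smooth_functions A \<Longrightarrow> h \<in> smooth_functions A \<Longrightarrow>
    v (\<lambda>q. f q * h q) = f p * v h + h p * v f"
  by (auto simp: tangent_space_def times_fun_def)

lemma tangent_spaceI:
  assumes "\<And>f. f \<notin> smooth_functions A \<Longrightarrow> v f = 0"
    and "\<And>f h. f \<in> smooth_functions A \<Longrightarrow> h \<in> smooth_functions A \<Longrightarrow> v (\<lambda>q. f q + h q) = v f + v h"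
    and "\<And>c f. f \<in> smooth_functions A \<Longrightarrow> v (\<lambda>q. c * f q) = c * v f"
    and "\<And>f h. f \<in> smooth_functions A \<Longrightarrow> h \<in> smooth_functions A \<Longrightarrow>
      v (\<lambda>q. f q * h q) = f p * v h + h p * v f"
  shows "v \<in> tangent_space A p"
  using assms by (auto simp: tangent_space_def plus_fun_def times_fun_def)

lemma tangent_space_zero: "0 \<in> tangent_space A p"
  by (auto simp: tangent_space_def)

lemma tangent_space_add:
  "v \<in> tangent_space A p \<Longrightarrow> w \<in> tangent_space A p \<Longrightarrow> v + w \<in> tangent_space A p"
  by (auto simp: tangent_space_def algebra_simps)

lemma tangent_space_scale: "v \<in> tangent_space A p \<Longrightarrow> c *\<^sub>t v \<in> tangent_space A p"
  by (auto simp: tangent_space_def scale_tangent_def algebra_simps)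

lemma tangent_const:
  assumes "v \<in> tangent_space A p"
  shows "v (\<lambda>_. c) = 0"
proof -
  have "v (\<lambda>_. 1) = 0"
    using tangent_Leibniz[OF assms smooth_functions_const[of 1] smooth_functions_const[of 1]]
    by simp
  then show ?thesis
    using tangent_cmult[OF assms smooth_functions_const[of 1], of c]
    by simp
qed

text \<open>If \<open>f\<close> and \<open>h\<close> agree on the manifold then \<open>d = f - h\<close> equals \<open>d \<kappa>\<close>, \<open>\<kappa>\<close> being the indicator
  of the complement, and both factors vanish at \<open>p\<close>, so the Leibniz rule kills \<open>v d\<close>. The lemma allows
  identities that hold on the manifold only to be differentiated.\<close>

lemma tangent_cong:
  assumes M: "smooth_manifold T A" and v: "v \<in> tangent_space A p" and p: "p \<in> points A"
    and f: "f \<in> smooth_functions A" and eq: "\<And>q. q \<in> points A \<Longrightarrow> f q = h q"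
  shows "v f = v h"
proof -
  have h: "h \<in> smooth_functions A" using smooth_functions_cong[OF M f eq] by blast
  let ?d = "\<lambda>q. f q + (- 1) * h q" and ?\<kappa> = "\<lambda>q. if q \<in> points A then 0 else 1 :: real"
  have mh: "(\<lambda>q. (- 1) * h q) \<in> smooth_functions A"
    by (rule smooth_functions_mult[OF M smooth_functions_const h])
  have d: "?d \<in> smooth_functions A"
    by (rule smooth_functions_add[OF M f mh])
  have \<kappa>: "?\<kappa> \<in> smooth_functions A"
    by (rule smooth_functions_cong[OF M smooth_functions_const[of 0]]) auto
  have "(\<lambda>q. ?d q * ?\<kappa> q) = ?d" using eq by auto
  then have "v ?d = 0"
    using tangent_Leibniz[OF v d \<kappa>] p eq by simp
  then show ?thesis
    using tangent_add[OF v f mh] tangent_cmult[OF v h, of "- 1"]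
    by simp
qed

lemma vector_fieldD:
  assumes "X \<in> vector_fields A"
  shows "p \<in> points A \<Longrightarrow> X p \<in> tangent_space A p"
    and "p \<notin> points A \<Longrightarrow> X p = 0"
    and "f \<in> smooth_functions A \<Longrightarrow> (\<lambda>p. X p f) \<in> smooth_functions A"
  using assms by (auto simp: vector_fields_def)

lemma vector_fields_add:
  assumes "smooth_manifold T A" and "X \<in> vector_fields A" and "Y \<in> vector_fields A"
  shows "X + Y \<in> vector_fields A"
  using assms by (auto simp: vector_fields_def intro: tangent_space_add smooth_functions_add)

lemma vector_fields_scale:
  assumes "smooth_manifold T A" and "h \<in> smooth_functions A" and "X \<in> vector_fields A"
  shows "h *\<^sub>f X \<in> vector_fields A"
  using assms tangent_space_scale[of "X _" A _ "h _"] smooth_functions_mult[OF assms(1,2)]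
  by (auto simp: vector_fields_def scale_field_def scale_tangent_def zero_fun_def)

section \<open>Extending a tangent vector to a vector field\<close>

definition coordinate_vector ::
    "('a, 'e::euclidean_space) chart set \<Rightarrow> 'a set \<Rightarrow> ('a \<Rightarrow> 'e) \<Rightarrow> 'e \<Rightarrow> 'a field" where
  "coordinate_vector A U x u q = (\<lambda>f. if f \<in> smooth_functions A
     then frechet_derivative (f \<circ> inv_into U x) (at (x q)) u else 0)"

lemma coordinate_vector_tangent:
  assumes M: "smooth_manifold T A" and c: "(U, x) \<in> A" and q: "q \<in> U"
  shows "coordinate_vector A U x u q \<in> tangent_space A q"
proof -
  note U = chart_facts[OF M c]
  have inv: "inv_into U x (x q) = q" using U(3) q by simp
  have der: "((f \<circ> inv_into U x) has_derivative
      frechet_derivative (f \<circ> inv_into U x) (at (x q))) (at (x q))"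
    if "f \<in> smooth_functions A" for f
    using smooth_on_differentiable[OF smooth_function_in_chart[OF that c]] q
    by (auto simp: frechet_derivative_works[symmetric])
  show ?thesis
  proof (rule tangent_spaceI)
    fix f h assume f: "f \<in> smooth_functions A" and h: "h \<in> smooth_functions A"
    note d = der[OF f] der[OF h]
    show "coordinate_vector A U x u q (\<lambda>q. f q + h q) =
      coordinate_vector A U x u q f + coordinate_vector A U x u q h"
      using frechet_derivative_at[OF has_derivative_add[OF d]] f h smooth_functions_add[OF M f h]
      by (simp add: coordinate_vector_def o_def fun_eq_iff)
    show "coordinate_vector A U x u q (\<lambda>q. f q * h q) =
      f q * coordinate_vector A U x u q h + h q * coordinate_vector A U x u q f"
      using frechet_derivative_at[OF has_derivative_mult[OF d]] f h smooth_functions_mult[OF M f h]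
      by (simp add: coordinate_vector_def o_def inv fun_eq_iff mult.commute)
  next
    fix f and k :: real assume f: "f \<in> smooth_functions A"
    show "coordinate_vector A U x u q (\<lambda>q. k * f q) = k * coordinate_vector A U x u q f"
      using frechet_derivative_at[OF has_derivative_mult_right[OF der[OF f], of k]] f
        smooth_functions_mult[OF M smooth_functions_const f]
      by (simp add: coordinate_vector_def o_def fun_eq_iff)
  qed (simp add: coordinate_vector_def)
qed

lemma cutoff_coordinate_field:
  fixes A :: "('a, 'e::euclidean_space) chart set" and \<beta> :: "'e \<Rightarrow> real"
  assumes M: "smooth_manifold T A" and c: "(U, x) \<in> A" and \<beta>: "smooth_on UNIV \<beta>"
    and C: "compact C" "C \<subseteq> x ` U" and zero: "\<And>z. z \<notin> C \<Longrightarrow> \<beta> z = 0"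
  shows "(\<lambda>q. if q \<in> U then \<beta> (x q) *\<^sub>t coordinate_vector A U x u q else 0) \<in> vector_fields A"
    (is "?X \<in> _")
proof -
  note U = chart_facts[OF M c]
  have "(\<lambda>q. ?X q f) \<in> smooth_functions A" if f: "f \<in> smooth_functions A" for f
  proof -
    let ?G = "\<lambda>z. \<beta> z * frechet_derivative (f \<circ> inv_into U x) (at z) u"
    have "smooth_on (x ` U) ?G"
      using smooth_on_subset[OF \<beta>] smooth_function_in_chart[OF f c]
      by (intro smooth_on_mult U smooth_on_derivative) auto
    then have "(\<lambda>q. if q \<in> U then ?G (x q) else 0) \<in> smooth_functions A"
      by (rule smooth_extension_by_zero[OF M c _ C]) (simp add: zero)
    also have "(\<lambda>q. if q \<in> U then ?G (x q) else 0) = (\<lambda>q. ?X q f)"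
      using f by (auto simp: fun_eq_iff scale_tangent_def coordinate_vector_def)
    finally show ?thesis .
  qed
  then show ?thesis
    using U(4) coordinate_vector_tangent[OF M c]
    by (auto simp: vector_fields_def intro: tangent_space_scale tangent_space_zero)
qed

lemma sum_scale_tangent_apply: "(\<Sum>i\<in>I. c i *\<^sub>t e i) f = (\<Sum>i\<in>I. c i * e i f)"
  by (induction I rule: infinite_finite_induct) (auto simp: scale_tangent_def)

text \<open>The differentials of the cut-off coordinate functions \<open>\<kappa> b\<close> give a linear map from the tangent
  space to the model space which maps the coordinate vector in direction \<open>u\<close> to \<open>u\<close>, hence is
  surjective. As the tangent space is spanned by \<open>DIM('e)\<close> vectors, the map is also injective, so
  every tangent vector is a coordinate vector, and those extend by \<open>cutoff_coordinate_field\<close>. As the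
  tangent space is only a set of functions, the dimension count is
  carried out on the coefficients with respect to the spanning family, which are packed into a vector
  \<open>w\<close> of the model space; \<open>F\<close> maps them to the coordinates.\<close>

lemma tangent_vector_extends:
  fixes A :: "('a, 'e::euclidean_space) chart set"
  assumes M: "smooth_manifold T A" and p: "p \<in> points A"
    and span: "\<And>v. v \<in> tangent_space A p \<Longrightarrow> \<exists>c. v = (\<Sum>i<DIM('e). c i *\<^sub>t e i)"
    and v: "v \<in> tangent_space A p"
  obtains X where "X \<in> vector_fields A" and "X p = v"
proof -
  obtain U x where c: "(U, x) \<in> A" and pU: "p \<in> U"
    using p by (auto simp: points_def)
  note U = chart_facts[OF M c]
  obtain r where r: "r > 0" "cball (x p) r \<subseteq> x ` U"
    using U(2) pU open_contains_cball by blast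
  obtain \<beta> :: "'e \<Rightarrow> real" where \<beta>: "smooth_on UNIV \<beta>" "\<beta> (x p) = 1"
    and zero: "\<And>z. z \<notin> cball (x p) r \<Longrightarrow> \<beta> z = 0"
    using smooth_bump_exists[OF r(1), of "x p"] by (metis ball_subset_cball subsetD)
  define \<kappa> where "\<kappa> b q = (if q \<in> U then \<beta> (x q) * (x q \<bullet> b - x p \<bullet> b) else 0)" for b q
  let ?\<delta> = "\<lambda>u. coordinate_vector A U x u p"
  have \<delta>: "?\<delta> u \<in> tangent_space A p" for u
    by (rule coordinate_vector_tangent[OF M c pU])
  have \<kappa>: "\<kappa> b \<in> smooth_functions A" for b
  proof -
    have "smooth_on (x ` U) (\<lambda>z. \<beta> z * (z \<bullet> b - x p \<bullet> b))"
      using smooth_on_subset[OF \<beta>(1)]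
        smooth_on_subset[OF smooth_on_linear_minus_const[OF bounded_linear_inner_left]]
      by (intro smooth_on_mult U) auto
    then show ?thesis
      unfolding \<kappa>_def using zero by (intro smooth_extension_by_zero[OF M c _ _ r(2)]) auto
  qed
  \<comment> \<open>Subtracting the value at \<open>p\<close> removes the derivative of \<open>\<beta>\<close> from the product rule.\<close>
  have \<delta>\<kappa>: "?\<delta> u (\<kappa> b) = u \<bullet> b" for u b
  proof -
    have "(\<beta> has_derivative frechet_derivative \<beta> (at (x p))) (at (x p))"
      using smooth_on_differentiable[OF \<beta>(1)] by (simp add: frechet_derivative_works[symmetric])
    moreover have "((\<lambda>z. z \<bullet> b - x p \<bullet> b) has_derivative (\<lambda>u. u \<bullet> b)) (at (x p))"
      by (auto intro!: derivative_eq_intros)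
    ultimately have "((\<lambda>z. \<beta> z * (z \<bullet> b - x p \<bullet> b)) has_derivative (\<lambda>u. u \<bullet> b)) (at (x p))"
      using has_derivative_mult \<beta>(2) by fastforce
    then have "((\<kappa> b \<circ> inv_into U x) has_derivative (\<lambda>u. u \<bullet> b)) (at (x p))"
      by (rule has_derivative_transform_within_open[OF _ U(2)])
        (use pU U(3) in \<open>auto simp: \<kappa>_def\<close>)
    from frechet_derivative_at[OF this, symmetric] show ?thesis
      using \<kappa> by (simp add: coordinate_vector_def)
  qed
  obtain \<iota> :: "nat \<Rightarrow> 'e" where \<iota>: "bij_betw \<iota> {..<DIM('e)} Basis"
    using ex_bij_betw_nat_finite[OF finite_Basis] by (auto simp: atLeast0LessThan)
  define F where "F w = (\<Sum>b\<in>Basis. (\<Sum>i<DIM('e). (w \<bullet> \<iota> i) * e i (\<kappa> b)) *\<^sub>R b)" for w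
  have lin: "linear F"
    unfolding F_def
    by (rule linearI) (simp_all add: inner_add_left distrib_right sum.distrib scaleR_add_left
        scaleR_sum_right sum_distrib_left mult.assoc)
  have coords: "\<exists>w. t = (\<Sum>i<DIM('e). (w \<bullet> \<iota> i) *\<^sub>t e i) \<and> F w = (\<Sum>b\<in>Basis. t (\<kappa> b) *\<^sub>R b)"
    if t: "t \<in> tangent_space A p" for t
  proof -
    obtain k where k: "t = (\<Sum>i<DIM('e). k i *\<^sub>t e i)" using span[OF t] by blast
    let ?w = "\<Sum>b\<in>Basis. k (inv_into {..<DIM('e)} \<iota> b) *\<^sub>R b"
    have "?w \<bullet> \<iota> i = k i" if "i < DIM('e)" for i
      using that \<iota> by (subst inner_sum_left_Basis) (auto simp: bij_betw_def)
    then have w: "t = (\<Sum>i<DIM('e). (?w \<bullet> \<iota> i) *\<^sub>t e i)" unfolding k by simp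
    moreover have "F ?w = (\<Sum>b\<in>Basis. t (\<kappa> b) *\<^sub>R b)"
      unfolding F_def by (subst w) (simp add: sum_scale_tangent_apply)
    ultimately show ?thesis by blast
  qed
  have \<delta>coords: "\<exists>w. ?\<delta> u = (\<Sum>i<DIM('e). (w \<bullet> \<iota> i) *\<^sub>t e i) \<and> F w = u" for u
    using coords[OF \<delta>[of u]] by (simp add: \<delta>\<kappa> euclidean_representation)
  then have "surj F" by (metis surjI)
  then have inj: "inj F" using linear_surjective_imp_injective[OF lin] by blast
  obtain w where w: "v = (\<Sum>i<DIM('e). (w \<bullet> \<iota> i) *\<^sub>t e i)" using coords[OF v] by blast
  obtain w' where w': "?\<delta> (F w) = (\<Sum>i<DIM('e). (w' \<bullet> \<iota> i) *\<^sub>t e i)" "F w' = F w"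
    using \<delta>coords by blast
  have "v = ?\<delta> (F w)" using w w' injD[OF inj w'(2)] by simp
  then have "(if p \<in> U then \<beta> (x p) *\<^sub>t ?\<delta> (F w) else 0) = v"
    using pU \<beta>(2) by (simp add: scale_tangent_def)
  then show thesis
    using that[OF cutoff_coordinate_field[OF M c \<beta>(1) compact_cball r(2) zero, where u = "F w"]]
    by blast
qed


section \<open>Weak almost contact B-metric structures\<close>

lemma endo_field_zero:
  assumes "endo_field A \<phi>" and "p \<in> points A"
  shows "\<phi> p 0 = 0"
proof -
  have "\<phi> p (0 *\<^sub>t 0) = 0 *\<^sub>t \<phi> p 0"
    using assms tangent_space_zero[of A p] unfolding endo_field_def by blast
  then show ?thesis by (simp add: scale_tangent_def zero_fun_def)
qed

text \<open>Put \<open>w = \<phi> \<xi>\<close>. Then \<open>\<phi> w = - Q \<xi> + \<xi> = 0\<close>, and \<open>0 = \<phi>\<^sup>2 w = - Q w + \<eta>(w) \<xi>\<close> shows that \<open>Q\<close> takes the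
  same value at \<open>w\<close> and at \<open>\<eta>(w) \<xi>\<close>. Since \<open>Q\<close> is nonsingular, \<open>w = \<eta>(w) \<xi>\<close>; applying \<open>\<phi>\<close> once more
  gives \<open>0 = \<eta>(w) w\<close>, hence \<open>\<eta>(w)\<^sup>2 = 0\<close> and \<open>w = 0\<close>.\<close>

lemma structure_endomorphism_kills_Reeb:
  assumes S: "weak_almost_contact A \<phi> Q \<xi> \<eta>" and p: "p \<in> points A"
  shows "\<phi> p (\<xi> p) = 0"
proof -
  let ?T = "tangent_space A p" and ?w = "\<phi> p (\<xi> p)"
  define a where "a = \<eta> p ?w"
  have \<phi>: "endo_field A \<phi>" and Q: "endo_field A Q" and inj: "inj_on (Q p) ?T"
    and \<eta>: "one_form A \<eta>" and \<xi>: "\<xi> p \<in> ?T" and \<eta>\<xi>: "\<eta> p (\<xi> p) = 1" and Q\<xi>: "Q p (\<xi> p) = \<xi> p"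
    and sq: "\<And>v. v \<in> ?T \<Longrightarrow> \<phi> p (\<phi> p v) = - Q p v + \<eta> p v *\<^sub>t \<xi> p"
    using S p by (auto simp: weak_almost_contact_def nonsingular_def bij_betw_def vector_fields_def)
  have w: "?w \<in> ?T" using \<phi> p \<xi> by (auto simp: endo_field_def)
  have \<phi>w: "\<phi> p ?w = 0"
    using sq[OF \<xi>] \<eta>\<xi> Q\<xi> by (simp add: scale_tangent_def)
  have "Q p ?w = a *\<^sub>t \<xi> p"
    using sq[OF w] endo_field_zero[OF \<phi> p] by (simp add: \<phi>w a_def add_eq_0_iff)
  also have "\<dots> = Q p (a *\<^sub>t \<xi> p)"
    using Q p \<xi> Q\<xi> by (simp add: endo_field_def)
  finally have wa: "?w = a *\<^sub>t \<xi> p"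
    using inj w \<xi> by (auto dest!: inj_onD intro: tangent_space_scale)
  have "\<phi> p ?w = a *\<^sub>t ?w"
    using \<phi> p \<xi> by (subst wa) (simp add: endo_field_def)
  then have "a *\<^sub>t ?w = 0" using \<phi>w by simp
  then have "\<eta> p (a *\<^sub>t ?w) = \<eta> p (0 *\<^sub>t ?w)" by (simp add: scale_tangent_def zero_fun_def)
  then have "a * a = 0"
    using \<eta> p w by (simp add: one_form_def a_def)
  then show ?thesis using wa by (simp add: scale_tangent_def zero_fun_def)
qed

lemma symmetric_tensor_zero:
  assumes "symmetric_tensor A g" and "p \<in> points A" and "v \<in> tangent_space A p"
  shows "g p v 0 = 0"
proof -
  have "g p (0 *\<^sub>t 0) v = 0 * g p 0 v"
    using assms tangent_space_zero[of A p] unfolding symmetric_tensor_def by blast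
  then have "g p 0 v = 0" by (simp add: scale_tangent_def zero_fun_def)
  then show ?thesis
    using assms tangent_space_zero[of A p] by (simp add: symmetric_tensor_def)
qed

lemma contact_form_is_metric_dual_of_Reeb:
  assumes S: "weak_almost_contact_B_metric A \<phi> Q \<xi> \<eta> g" and p: "p \<in> points A"
    and X: "X \<in> vector_fields A"
  shows "g p (X p) (\<xi> p) = \<eta> p (X p)"
proof -
  have W: "weak_almost_contact A \<phi> Q \<xi> \<eta>" and g: "symmetric_tensor A g"
    and \<xi>: "\<xi> \<in> vector_fields A" and \<phi>: "endo_field A \<phi>"
    and \<eta>\<xi>: "\<eta> p (\<xi> p) = 1" and Q\<xi>: "Q p (\<xi> p) = \<xi> p"
    using S p by (auto simp: weak_almost_contact_B_metric_def weak_almost_contact_def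
        semi_riemannian_metric_def)
  have "\<phi> p (X p) \<in> tangent_space A p"
    using \<phi> p vector_fieldD(1)[OF X p] by (simp add: endo_field_def)
  then have "g p (\<phi> p (X p)) (\<phi> p (\<xi> p)) = 0"
    using symmetric_tensor_zero[OF g p] structure_endomorphism_kills_Reeb[OF W p] by simp
  moreover have "g p (\<phi> p (X p)) (\<phi> p (\<xi> p)) = - g p (X p) (Q p (\<xi> p)) + \<eta> p (X p) * \<eta> p (\<xi> p)"
    using S X \<xi> p unfolding weak_almost_contact_B_metric_def by blast
  ultimately show ?thesis by (simp add: \<eta>\<xi> Q\<xi>)
qed

theorem proposition20:
  fixes T :: "'a topology"
    and A :: "('a, 'e::euclidean_space) chart set"
    and n :: nat
    and \<phi> Q :: "'a \<Rightarrow> 'a tangent \<Rightarrow> 'a tangent"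
    and \<xi> :: "'a field"
    and \<eta> :: "'a \<Rightarrow> 'a tangent \<Rightarrow> real"
    and g :: "'a \<Rightarrow> 'a tangent \<Rightarrow> 'a tangent \<Rightarrow> real"
    and nabla :: "'a field \<Rightarrow> 'a field \<Rightarrow> 'a field"
  assumes "smooth_manifold T A"
    and "n \<ge> 1" and "DIM('e) = 2 * n + 1"
    and "weak_almost_contact_B_metric A \<phi> Q \<xi> \<eta> g"
    and "levi_civita_connection A g nabla"
  shows "(parallel_distribution A nabla (kernel_distribution A \<eta>) \<longleftrightarrow> parallel_form A nabla \<eta>) \<and>
         (parallel_form A nabla \<eta> \<longleftrightarrow> parallel_field A nabla \<xi>)"
proof -
  note M = assms(1) and S = assms(4)
  have \<xi>: "\<xi> \<in> vector_fields A" and \<eta>: "one_form A \<eta>" and g: "symmetric_tensor A g"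
    and nondeg: "nondegenerate A g" and \<eta>\<xi>: "\<And>p. p \<in> points A \<Longrightarrow> \<eta> p (\<xi> p) = 1"
    using S by (auto simp: weak_almost_contact_B_metric_def weak_almost_contact_def
        semi_riemannian_metric_def)
  have conn: "affine_connection A nabla"
    using assms(5) by (simp add: levi_civita_connection_def)
  then have nabla: "\<And>X Y. X \<in> vector_fields A \<Longrightarrow> Y \<in> vector_fields A \<Longrightarrow> nabla X Y \<in> vector_fields A"
    by (simp add: affine_connection_def)
  note dual = contact_form_is_metric_dual_of_Reeb[OF S]
  have smooth_\<eta>: "(\<lambda>q. \<eta> q (Y q)) \<in> smooth_functions A" if "Y \<in> vector_fields A" for Y
    using \<eta> that by (simp add: one_form_def)
  \<comment> \<open>\<open>\<eta>\<close> equals \<open>g(\<cdot>, \<xi>)\<close>, and the connection is metric.\<close>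
  have metric: "X p (\<lambda>q. \<eta> q (Y q)) = \<eta> p (nabla X Y p) + g p (Y p) (nabla X \<xi> p)"
    if X: "X \<in> vector_fields A" and Y: "Y \<in> vector_fields A" and p: "p \<in> points A" for X Y p
  proof -
    have "X p (\<lambda>q. \<eta> q (Y q)) = X p (\<lambda>q. g q (Y q) (\<xi> q))"
      using dual[OF _ Y]
      by (intro tangent_cong[OF M vector_fieldD(1)[OF X p] p smooth_\<eta>[OF Y]]) simp
    also have "\<dots> = g p (nabla X Y p) (\<xi> p) + g p (Y p) (nabla X \<xi> p)"
      using assms(5) X Y \<xi> p by (simp add: levi_civita_connection_def metric_connection_def)
    finally show ?thesis by (simp add: dual[OF p nabla[OF X Y]])
  qed
  have cov: "covariant_derivative_form nabla \<eta> X Y p = g p (Y p) (nabla X \<xi> p)"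
    if "X \<in> vector_fields A" and "Y \<in> vector_fields A" and "p \<in> points A" for X Y p
    using metric[OF that] by (simp add: covariant_derivative_form_def)
  \<comment> \<open>Differentiating \<open>\<eta>(\<xi>) = 1\<close> produces this number twice, because \<open>g\<close> is symmetric.\<close>
  have unit: "\<eta> p (nabla X \<xi> p) = 0" if X: "X \<in> vector_fields A" and p: "p \<in> points A" for X p
  proof -
    note t = vector_fieldD(1)[OF X p]
    have "0 = X p (\<lambda>_. 1)" using tangent_const[OF t] by simp
    also have "\<dots> = X p (\<lambda>q. \<eta> q (\<xi> q))"
      by (rule tangent_cong[OF M t p smooth_functions_const]) (simp add: \<eta>\<xi>)
    also have "\<dots> = \<eta> p (nabla X \<xi> p) + g p (\<xi> p) (nabla X \<xi> p)"
      by (rule metric[OF X \<xi> p])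
    also have "g p (\<xi> p) (nabla X \<xi> p) = \<eta> p (nabla X \<xi> p)"
      using g p vector_fieldD(1)[OF \<xi> p] vector_fieldD(1)[OF nabla[OF X \<xi>] p] dual[OF p nabla[OF X \<xi>]]
      by (simp add: symmetric_tensor_def)
    finally show ?thesis by simp
  qed
  have extend: "\<exists>Y\<in>vector_fields A. Y p = v" if p: "p \<in> points A" and v: "v \<in> tangent_space A p" for p v
  proof -
    obtain \<nu> where "has_index A g \<nu> p"
      using S p by (auto simp: weak_almost_contact_B_metric_def semi_riemannian_metric_def)
    then obtain e where "\<forall>v\<in>tangent_space A p. \<exists>c. v = (\<Sum>i<DIM('e). c i *\<^sub>t e i)"
      by (auto simp: has_index_def)
    then show ?thesis using tangent_vector_extends[OF M p _ v, of e] by blast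
  qed
  have "parallel_field A nabla \<xi>" if par: "parallel_form A nabla \<eta>"
    unfolding parallel_field_def
  proof
    fix X assume X: "X \<in> vector_fields A"
    note N = vector_fieldD[OF nabla[OF X \<xi>]]
    have "nabla X \<xi> p = 0" if p: "p \<in> points A" for p
    proof -
      have "g p (nabla X \<xi> p) v = 0" if v: "v \<in> tangent_space A p" for v
      proof -
        obtain Y where Y: "Y \<in> vector_fields A" "Y p = v" using extend[OF p v] by blast
        then have "g p v (nabla X \<xi> p) = 0"
          using cov[OF X Y(1) p] par X p by (simp add: parallel_form_def)
        then show ?thesis using g p v N(1)[OF p] by (simp add: symmetric_tensor_def)
      qed
      then show ?thesis using nondeg p N(1)[OF p] by (simp add: nondegenerate_def)
    qed
    then show "nabla X \<xi> = 0" using N(2) by (auto simp: fun_eq_iff)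
  qed
  moreover have "parallel_form A nabla \<eta>" if par: "parallel_field A nabla \<xi>"
    unfolding parallel_form_def
  proof (intro ballI)
    fix X Y p assume X: "X \<in> vector_fields A" and Y: "Y \<in> vector_fields A" and p: "p \<in> points A"
    have "nabla X \<xi> p = 0" using par X by (simp add: parallel_field_def)
    then show "covariant_derivative_form nabla \<eta> X Y p = 0"
      using cov[OF X Y p] symmetric_tensor_zero[OF g p vector_fieldD(1)[OF Y p]] by simp
  qed
  moreover have "parallel_distribution A nabla (kernel_distribution A \<eta>)"
    if par: "parallel_form A nabla \<eta>"
    unfolding parallel_distribution_def
  proof (intro ballI)
    fix X Y assume X: "X \<in> vector_fields A" and "Y \<in> sections A (kernel_distribution A \<eta>)"
    then have Y: "Y \<in> vector_fields A" and Y0: "\<And>q. q \<in> points A \<Longrightarrow> \<eta> q (Y q) = 0"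
      by (auto simp: sections_def kernel_distribution_def)
    have "\<eta> p (nabla X Y p) = 0" if p: "p \<in> points A" for p
    proof -
      note t = vector_fieldD(1)[OF X p]
      have "\<eta> p (nabla X Y p) = X p (\<lambda>q. \<eta> q (Y q))"
        using par X Y p by (simp add: parallel_form_def covariant_derivative_form_def)
      also have "\<dots> = X p (\<lambda>_. 0)"
        by (rule tangent_cong[OF M t p smooth_\<eta>[OF Y]]) (rule Y0)
      finally show ?thesis using tangent_const[OF t] by simp
    qed
    then show "nabla X Y \<in> sections A (kernel_distribution A \<eta>)"
      using nabla[OF X Y] vector_fieldD(1) by (auto simp: sections_def kernel_distribution_def)
  qed
  moreover have "parallel_form A nabla \<eta>"
    if par: "parallel_distribution A nabla (kernel_distribution A \<eta>)"
    unfolding parallel_form_def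
  proof (intro ballI)
    fix X Y p assume X: "X \<in> vector_fields A" and Y: "Y \<in> vector_fields A" and p: "p \<in> points A"
    let ?f = "\<lambda>q. \<eta> q (Y q)"
    \<comment> \<open>The projection of \<open>Y\<close> along \<open>\<xi>\<close> is a section of the distribution, so
      \<open>\<nabla>\<^sub>X Y = \<nabla>\<^sub>X Z + X(\<eta>(Y)) \<xi> + \<eta>(Y) \<nabla>\<^sub>X \<xi>\<close>, where \<open>\<eta>\<close> kills the first and the last term.\<close>
    define Z where "Z = Y + (\<lambda>q. (- 1) * ?f q) *\<^sub>f \<xi>"
    have \<eta>add: "\<eta> q (v + c *\<^sub>t w) = \<eta> q v + c * \<eta> q w"
      if "q \<in> points A" and "v \<in> tangent_space A q" and "w \<in> tangent_space A q" for q v w c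
      using \<eta> that tangent_space_scale[OF that(3)] by (simp add: one_form_def)
    have mf: "(\<lambda>q. (- 1) * ?f q) \<in> smooth_functions A"
      by (rule smooth_functions_mult[OF M smooth_functions_const smooth_\<eta>[OF Y]])
    have f\<xi>: "?f *\<^sub>f \<xi> \<in> vector_fields A"
      by (rule vector_fields_scale[OF M smooth_\<eta>[OF Y] \<xi>])
    have Z: "Z \<in> vector_fields A"
      unfolding Z_def by (intro vector_fields_add[OF M Y] vector_fields_scale[OF M mf \<xi>])
    have "\<eta> q (Z q) = 0" if q: "q \<in> points A" for q
      using \<eta>add[OF q vector_fieldD(1)[OF Y q] vector_fieldD(1)[OF \<xi> q], of "- ?f q"]
      by (simp add: Z_def scale_field_def \<eta>\<xi>[OF q])
    then have "Z \<in> sections A (kernel_distribution A \<eta>)"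
      using Z vector_fieldD(1)[OF Z] by (simp add: sections_def kernel_distribution_def)
    then have nZ: "\<eta> p (nabla X Z p) = 0"
      using par X p by (auto simp: parallel_distribution_def sections_def kernel_distribution_def)
    have YZ: "Y = Z + ?f *\<^sub>f \<xi>"
      by (simp add: Z_def fun_eq_iff scale_field_def scale_tangent_def)
    have "nabla X Y = nabla X Z + nabla X (?f *\<^sub>f \<xi>)"
      using conn X Z f\<xi> by (subst YZ) (simp add: affine_connection_def)
    also have "nabla X (?f *\<^sub>f \<xi>) = (\<lambda>p. X p ?f) *\<^sub>f \<xi> + ?f *\<^sub>f nabla X \<xi>"
      using conn X \<xi> smooth_\<eta>[OF Y] by (simp add: affine_connection_def)
    finally have "nabla X Y p = nabla X Z p + X p ?f *\<^sub>t \<xi> p + ?f p *\<^sub>t nabla X \<xi> p"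
      by (simp add: fun_eq_iff scale_field_def)
    then have "\<eta> p (nabla X Y p) = X p ?f"
      using \<eta>add[OF p] vector_fieldD(1)[OF nabla[OF X Z] p] vector_fieldD(1)[OF \<xi> p]
        vector_fieldD(1)[OF nabla[OF X \<xi>] p]
      by (simp add: nZ unit[OF X p] \<eta>\<xi>[OF p] tangent_space_add tangent_space_scale)
    then show "covariant_derivative_form nabla \<eta> X Y p = 0"
      by (simp add: covariant_derivative_form_def)
  qed
  ultimately show ?thesis by blast
qed

end
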